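(* Assume that $d\ge2$. Let $X$ be a random vector in $\mathbb R^d$ such that $\mathbb E[XX^\top]=I_d$. Then for every $t\in[0,1]$, $$\sup_{\theta\in S^{d-1}}\mathbb P\big(|\langle\theta,X\rangle|\le t\big)\ge 0.16\cdot t,$$ and therefore $$\mathbb P\big(\lambda_{\min}(\widehat\Sigma_n)\le t\big)\ge(0.025\cdot t)^{n/2}.$$
   Context: $n\ge1$ is an integer, $X_1,\dots,X_n$ are i.i.d. copies of $X$, $\widehat\Sigma_n=\frac1n\sum_{i=1}^nX_iX_i^\top$, $\lambda_{\min}(A)$ denotes the smallest eigenvalue of a symmetric matrix $A$, $S^{d-1}$ is the Euclidean unit sphere of $\mathbb R^d$ and $I_d$ the identity matrix. *)

theory Defs
  imports "HOL-Probability.Probability"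
begin

definition outer_self :: "real ^ 'd \<Rightarrow> real ^ 'd ^ 'd" where
  "outer_self x = (\<chi> i j. x $ i * x $ j)"

definition eigenvalue :: "real ^ 'd ^ 'd \<Rightarrow> real \<Rightarrow> bool" where
  "eigenvalue A l \<longleftrightarrow> (\<exists>v. v \<noteq> 0 \<and> A *v v = l *\<^sub>R v)"

text \<open>Only meant for symmetric matrices, whose set of real eigenvalues is finite and nonempty.\<close>

definition lambda_min :: "real ^ 'd ^ 'd \<Rightarrow> real" where
  "lambda_min A = Min {l. eigenvalue A l}"

definition sample_cov :: "nat \<Rightarrow> (nat \<Rightarrow> real ^ 'd) \<Rightarrow> real ^ 'd ^ 'd" where
  "sample_cov n x = (1 / real n) *\<^sub>R (\<Sum>i=1..n. outer_self (x i))"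

text \<open>The copies may live on a probability space \<open>N\<close> different from the space \<open>M\<close> of \<open>X\<close>.
  Measurability of each \<open>Y i\<close> is part of \<open>indep_vars\<close>.\<close>

definition iid_copies ::
  "'a measure \<Rightarrow> ('a \<Rightarrow> real ^ 'd) \<Rightarrow> 'b measure \<Rightarrow> nat \<Rightarrow> (nat \<Rightarrow> 'b \<Rightarrow> real ^ 'd) \<Rightarrow> bool" where
  "iid_copies M X N n Y \<longleftrightarrow>
     prob_space N \<and> prob_space.indep_vars N (\<lambda>_. borel) Y {1..n} \<and>
     (\<forall>i\<in>{1..n}. distr N borel (Y i) = distr M borel X)"

text \<open>\<open>E[X X\<^sup>T] = I\<close> as a matrix-valued Bochner integral. Since the integral of a
  non-integrable function is \<open>0 \<noteq> mat 1\<close>, this entails integrability.\<close>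

definition isotropic :: "'a measure \<Rightarrow> ('a \<Rightarrow> real ^ 'd) \<Rightarrow> bool" where
  "isotropic M X \<longleftrightarrow> (\<integral>\<omega>. outer_self (X \<omega>) \<partial>M) = mat 1"

end

theory Submission
  imports Defs
begin

text \<open>
  A two-dimensional effect is behind the first bound. Fix two coordinates \<open>U\<close>, \<open>V\<close> of \<open>X\<close>; they have
  second moment \<open>1\<close>. A fixed direction may well miss the slab \<open>\<bar>\<langle>\<theta>,X\<rangle>\<bar> \<le> t\<close> almost surely, but a
  random direction in the plane of the two coordinates is nearly orthogonal to any given point of
  the plane with probability of order \<open>t\<close> divided by the size of that point. By Fubini some direction
  does at least as well as this average.

  The average over the circle is replaced by one over slopes: the directions \<open>U + s V\<close> and
  \<open>V + s U\<close> with \<open>s \<in> [-1,1]\<close> cover the projective line, no trigonometry is needed, and passing to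
  unit vectors only shrinks the inner product. For a point \<open>(x,y)\<close> with \<open>\<bar>x\<bar> \<le> \<bar>y\<bar>\<close> the slopes with
  \<open>\<bar>x + s y\<bar> \<le> t\<close> have length at least \<open>min 1 (t/\<bar>y\<bar>) \<ge> t (1 - 4 y\<^sup>2 / 27)\<close>
  (\<open>slope_measure_lower_bound\<close>). This quadratic minorant turns the second moment
  \<open>E[U\<^sup>2 + V\<^sup>2] = 2\<close> into an average length of at least \<open>19 t / 27\<close>. The two families of slopes have total length
  \<open>4\<close>, so some direction has probability at least \<open>19 t / 108 > 0.16 t\<close>, up to an arbitrarily
  small loss (\<open>small_ball_sup_bound\<close>).

  The second bound uses that \<open>\<lambda>\<^sub>m\<^sub>i\<^sub>n\<close> of the sample covariance is the minimum of
  \<open>(1/n) \<Sum> \<langle>\<theta>,Y\<^sub>i\<rangle>\<^sup>2\<close> over the unit sphere (\<open>lambda_min_le_iff\<close>), hence at most \<open>t\<close> as soon as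
  one direction has \<open>\<bar>\<langle>\<theta>,Y\<^sub>i\<rangle>\<bar> \<le> \<surd>t\<close> for all \<open>i\<close>. By independence this has probability at least
  \<open>(0.16 \<surd>t)\<^sup>n\<close>, and \<open>0.16\<^sup>2 = 0.0256 > 0.025\<close>.
\<close>

section \<open>Averaging over directions in a plane\<close>

text \<open>The admissible slopes form an interval around \<open>s0 = - x / y\<close>, which lies in \<open>[-1,1]\<close>, of half-width
  \<open>t / \<bar>y\<bar>\<close>. The half of it pointing towards \<open>0\<close> stays in \<open>[-1,1]\<close> up to length \<open>1\<close>. The bound is the
  tangent to \<open>r \<mapsto> 1 / \<surd>r\<close> through the point \<open>(0,1)\<close>, evaluated at \<open>r = y\<^sup>2\<close>: the best affine minorant of
  \<open>min 1 (1 / \<surd>r)\<close> with value \<open>1\<close> at \<open>0\<close>.\<close>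

lemma slope_measure_lower_bound:
  fixes x y t :: real
  assumes xy: "\<bar>x\<bar> \<le> \<bar>y\<bar>" and t: "0 \<le> t" "t \<le> 1"
  shows "ennreal (t * (1 - 4 / 27 * y\<^sup>2)) \<le> emeasure lborel {s\<in>{-1..1}. \<bar>x + s * y\<bar> \<le> t}"
proof -
  let ?S = "{s\<in>{-1..1}. \<bar>x + s * y\<bar> \<le> t}"
  define h where "h = t * (1 - 4 / 27 * y\<^sup>2)"
  have meas: "?S \<in> sets lborel" by measurable
  have h_le: "h \<le> 1"
  proof -
    have "h \<le> t * 1" unfolding h_def using t by (intro mult_left_mono) auto
    then show ?thesis using t by simp
  qed
  show ?thesis
  proof (cases "h \<le> 0")
    case True
    then show ?thesis by (simp add: h_def ennreal_neg)
  next
    case False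
    have interval: ?thesis if "{a..a + h} \<subseteq> ?S" for a
      using emeasure_mono[OF that meas] False by (simp add: h_def)
    show ?thesis
    proof (cases "y = 0")
      case True
      then show ?thesis
        using xy t h_le by (intro interval[of 0]) auto
    next
      case y: False
      define s0 where "s0 = - x / y"
      have s0: "\<bar>s0\<bar> \<le> 1" using xy y by (simp add: s0_def abs_divide)
      (* The tangent inequality: \<bar>y\<bar> (1 - 4 y^2 / 27) \<le> 1, with equality at \<bar>y\<bar> = 3/2. *)
      have "0 \<le> (2 * \<bar>y\<bar> - 3)\<^sup>2 * (\<bar>y\<bar> + 3)" by simp
      also have "\<dots> = 27 - 27 * (\<bar>y\<bar> * (1 - 4 / 27 * \<bar>y\<bar>\<^sup>2))"
        by (simp add: algebra_simps power2_eq_square)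
      finally have "\<bar>y\<bar> * (1 - 4 / 27 * y\<^sup>2) \<le> 1" by simp
      from mult_left_mono[OF this t(1)] have hy: "\<bar>y\<bar> * h \<le> t"
        by (simp add: h_def algebra_simps)
      have near: "\<bar>x + s * y\<bar> \<le> t" if "\<bar>s - s0\<bar> \<le> h" for s
      proof -
        have "x + s * y = y * (s - s0)" using y by (simp add: s0_def field_simps)
        then have "\<bar>x + s * y\<bar> = \<bar>y\<bar> * \<bar>s - s0\<bar>" by (simp add: abs_mult)
        also have "\<dots> \<le> \<bar>y\<bar> * h" using that by (intro mult_left_mono) auto
        finally show ?thesis using hy by simp
      qed
      show ?thesis
      proof (cases "s0 \<ge> 0")
        case True
        then show ?thesis
          using s0 h_le by (intro interval[of "s0 - h"]) (auto intro!: near)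
      next
        case False
        then show ?thesis
          using s0 h_le by (intro interval[of s0]) (auto intro!: near)
      qed
    qed
  qed
qed

lemma slope_Fubini:
  fixes U V :: "'a \<Rightarrow> real"
  assumes "prob_space M" and [measurable]: "U \<in> borel_measurable M" "V \<in> borel_measurable M"
  shows "(\<integral>\<^sup>+\<omega>. emeasure lborel {s\<in>{-1..1}. \<bar>U \<omega> + s * V \<omega>\<bar> \<le> t} \<partial>M)
    = (\<integral>\<^sup>+s\<in>{-1..1}. emeasure M {\<omega>\<in>space M. \<bar>U \<omega> + s * V \<omega>\<bar> \<le> t} \<partial>lborel)"
proof -
  interpret M: prob_space M by fact
  interpret P: pair_sigma_finite M lborel ..
  define A where "A = {p \<in> space (M \<Otimes>\<^sub>M lborel). snd p \<in> {-1..1} \<and> \<bar>U (fst p) + snd p * V (fst p)\<bar> \<le> t}"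
  have A: "A \<in> sets (M \<Otimes>\<^sub>M lborel)" unfolding A_def by measurable
  have "(\<integral>\<^sup>+\<omega>. emeasure lborel {s\<in>{-1..1}. \<bar>U \<omega> + s * V \<omega>\<bar> \<le> t} \<partial>M) = emeasure (M \<Otimes>\<^sub>M lborel) A"
    unfolding lborel.emeasure_pair_measure_alt[OF A]
    by (intro nn_integral_cong arg_cong[where f = "emeasure lborel"])
      (auto simp: A_def space_pair_measure)
  also have "\<dots> = (\<integral>\<^sup>+s\<in>{-1..1}. emeasure M {\<omega>\<in>space M. \<bar>U \<omega> + s * V \<omega>\<bar> \<le> t} \<partial>lborel)"
    unfolding P.emeasure_pair_measure_alt2[OF A]
  proof (intro nn_integral_cong)
    fix s :: real
    have "(\<lambda>\<omega>. (\<omega>, s)) -` A = (if s \<in> {-1..1} then {\<omega>\<in>space M. \<bar>U \<omega> + s * V \<omega>\<bar> \<le> t} else {})"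
      by (auto simp: A_def space_pair_measure)
    then show "emeasure M ((\<lambda>\<omega>. (\<omega>, s)) -` A)
      = emeasure M {\<omega>\<in>space M. \<bar>U \<omega> + s * V \<omega>\<bar> \<le> t} * indicator {-1..1} s"
      by (simp add: indicator_def)
  qed
  finally show ?thesis .
qed

text \<open>Since \<open>c\<close> bounds the probability for every slope, integrating over both families of slopes in
  \<open>[-1,1]\<close> gives at most \<open>4 c\<close>; the pointwise length bound gives at least \<open>19 t / 27\<close>. Stating
  the result for an arbitrary upper bound \<open>c\<close> covers both the supremum and, by contradiction, the existence of
  a direction that beats any smaller constant.\<close>

lemma (in prob_space) uniform_slope_bound:
  fixes U V :: "'a \<Rightarrow> real"
  assumes [measurable]: "U \<in> borel_measurable M" "V \<in> borel_measurable M"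
    and int: "integrable M (\<lambda>\<omega>. (U \<omega>)\<^sup>2)" "integrable M (\<lambda>\<omega>. (V \<omega>)\<^sup>2)"
    and moment: "expectation (\<lambda>\<omega>. (U \<omega>)\<^sup>2) + expectation (\<lambda>\<omega>. (V \<omega>)\<^sup>2) \<le> 2"
    and t: "0 \<le> t" "t \<le> 1"
    and U_le: "\<And>s. prob {\<omega>\<in>space M. \<bar>U \<omega> + s * V \<omega>\<bar> \<le> t} \<le> c"
    and V_le: "\<And>s. prob {\<omega>\<in>space M. \<bar>V \<omega> + s * U \<omega>\<bar> \<le> t} \<le> c"
  shows "19 / 108 * t \<le> c"
proof -
  define L where "L x y = emeasure lborel {s\<in>{-1..1}. \<bar>x + s * y\<bar> \<le> t}" for x y :: real
  have c: "0 \<le> c" using U_le[of 0] measure_nonneg order_trans by blast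
  have upper: "(\<integral>\<^sup>+\<omega>. L (F \<omega>) (G \<omega>) \<partial>M) \<le> ennreal (2 * c)"
    if [measurable]: "F \<in> borel_measurable M" "G \<in> borel_measurable M"
      and le: "\<And>s. prob {\<omega>\<in>space M. \<bar>F \<omega> + s * G \<omega>\<bar> \<le> t} \<le> c" for F G :: "'a \<Rightarrow> real"
  proof -
    have "(\<integral>\<^sup>+\<omega>. L (F \<omega>) (G \<omega>) \<partial>M)
      = (\<integral>\<^sup>+s\<in>{-1..1}. emeasure M {\<omega>\<in>space M. \<bar>F \<omega> + s * G \<omega>\<bar> \<le> t} \<partial>lborel)"
      unfolding L_def by (intro slope_Fubini prob_space_axioms) measurable
    also have "\<dots> \<le> (\<integral>\<^sup>+s\<in>{-1..1::real}. ennreal c \<partial>lborel)"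
      using le by (intro nn_integral_mono mult_right_mono) (simp_all add: emeasure_eq_measure ennreal_leI)
    also have "\<dots> = ennreal (2 * c)"
      using c by (simp add: nn_integral_cmult_indicator ennreal_mult' mult.commute)
    finally show ?thesis .
  qed
  have L_meas[measurable]: "(\<lambda>\<omega>. L (F \<omega>) (G \<omega>)) \<in> borel_measurable M"
    if [measurable]: "F \<in> borel_measurable M" "G \<in> borel_measurable M" for F G :: "'a \<Rightarrow> real"
  proof -
    have "{p \<in> space (M \<Otimes>\<^sub>M lborel). snd p \<in> {-1..1} \<and> \<bar>F (fst p) + snd p * G (fst p)\<bar> \<le> t}
        \<in> sets (M \<Otimes>\<^sub>M lborel)" (is "?A \<in> _") by measurable
    then have "(\<lambda>\<omega>. emeasure lborel (Pair \<omega> -` ?A)) \<in> borel_measurable M"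
      by (rule lborel.measurable_emeasure_Pair)
    also have "?this \<longleftrightarrow> ?thesis"
      unfolding L_def by (intro measurable_cong arg_cong[where f = "emeasure lborel"])
        (auto simp: space_pair_measure)
    finally show ?thesis .
  qed
  (* The coordinate of larger absolute value decides which family of slopes does the work. *)
  have pointwise: "ennreal (t * (1 - 4 / 27 * (x\<^sup>2 + y\<^sup>2))) \<le> L x y + L y x" for x y
  proof (cases "\<bar>x\<bar> \<le> \<bar>y\<bar>")
    case True
    have "ennreal (t * (1 - 4 / 27 * (x\<^sup>2 + y\<^sup>2))) \<le> ennreal (t * (1 - 4 / 27 * y\<^sup>2))"
      using t by (intro ennreal_leI mult_left_mono) auto
    also have "\<dots> \<le> L x y"
      unfolding L_def using True t by (rule slope_measure_lower_bound)
    finally show ?thesis by (rule order_trans) simp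
  next
    case False
    have "ennreal (t * (1 - 4 / 27 * (x\<^sup>2 + y\<^sup>2))) \<le> ennreal (t * (1 - 4 / 27 * x\<^sup>2))"
      using t by (intro ennreal_leI mult_left_mono) auto
    also have "\<dots> \<le> L y x"
      unfolding L_def using False t by (intro slope_measure_lower_bound) auto
    finally show ?thesis by (rule order_trans) simp
  qed
  let ?g = "\<lambda>\<omega>. t * (1 - 4 / 27 * ((U \<omega>)\<^sup>2 + (V \<omega>)\<^sup>2))"
  have intg: "integrable M ?g" using int by auto
  have "t * (19 / 27) \<le> t * (1 - 4 / 27 * (expectation (\<lambda>\<omega>. (U \<omega>)\<^sup>2) + expectation (\<lambda>\<omega>. (V \<omega>)\<^sup>2)))"
    using moment t by (intro mult_left_mono) auto
  also have "\<dots> = expectation ?g" using int by (simp add: prob_space)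
  also have "ennreal \<dots> \<le> (\<integral>\<^sup>+\<omega>. ennreal (?g \<omega>) \<partial>M)"
  proof -
    have "expectation ?g \<le> expectation (\<lambda>\<omega>. max 0 (?g \<omega>))"
      using intg by (intro integral_mono integrable_max) auto
    then have "ennreal (expectation ?g) \<le> ennreal (expectation (\<lambda>\<omega>. max 0 (?g \<omega>)))"
      by (rule ennreal_leI)
    also have "\<dots> = (\<integral>\<^sup>+\<omega>. ennreal (max 0 (?g \<omega>)) \<partial>M)"
      using intg by (intro nn_integral_eq_integral[symmetric] integrable_max) auto
    finally show ?thesis by (simp add: ennreal_max_0)
  qed
  also have "\<dots> \<le> (\<integral>\<^sup>+\<omega>. L (U \<omega>) (V \<omega>) + L (V \<omega>) (U \<omega>) \<partial>M)"
    by (intro nn_integral_mono pointwise)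
  also have "\<dots> = (\<integral>\<^sup>+\<omega>. L (U \<omega>) (V \<omega>) \<partial>M) + (\<integral>\<^sup>+\<omega>. L (V \<omega>) (U \<omega>) \<partial>M)"
    by (intro nn_integral_add) measurable
  also have "\<dots> \<le> ennreal (2 * c) + ennreal (2 * c)"
    by (intro add_mono upper U_le V_le) measurable
  also have "\<dots> = ennreal (4 * c)" using c by (simp flip: ennreal_plus)
  finally show ?thesis using c by (simp add: ennreal_le_iff ennreal_leI)
qed

lemma isotropic_second_moment:
  fixes X :: "'a \<Rightarrow> real ^ 'd"
  assumes "isotropic M X"
  shows "integrable M (\<lambda>\<omega>. (X \<omega> $ i)\<^sup>2)" and "(\<integral>\<omega>. (X \<omega> $ i)\<^sup>2 \<partial>M) = 1"
proof -
  have I: "(\<integral>\<omega>. outer_self (X \<omega>) \<partial>M) = mat 1" using assms by (simp add: isotropic_def)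
  have "(mat 1 :: real^'d^'d) \<noteq> 0" by (auto simp: vec_eq_iff mat_def)
  then have int: "integrable M (\<lambda>\<omega>. outer_self (X \<omega>))"
    using I not_integrable_integral_eq by metis
  have bl: "bounded_linear (\<lambda>A :: real^'d^'d. A $ i $ i)"
    by (intro bounded_linear_compose[OF bounded_linear_vec_nth] bounded_linear_vec_nth)
  have eq: "outer_self (X \<omega>) $ i $ i = (X \<omega> $ i)\<^sup>2" for \<omega>
    by (simp add: outer_self_def power2_eq_square)
  show "integrable M (\<lambda>\<omega>. (X \<omega> $ i)\<^sup>2)"
    using integrable_bounded_linear[OF bl int] by (simp add: eq)
  show "(\<integral>\<omega>. (X \<omega> $ i)\<^sup>2 \<partial>M) = 1"
    using integral_bounded_linear[OF bl int] by (simp add: eq I mat_def)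
qed

text \<open>A direction \<open>e\<^sub>k + s e\<^sub>l\<close> has norm at least \<open>1\<close>, so normalising it can only enlarge the event
  that the inner product with \<open>X\<close> is small.\<close>

lemma small_ball_sup_bound:
  fixes M :: "'a measure" and X :: "'a \<Rightarrow> real ^ 'd" and t :: real
  assumes d: "CARD('d) \<ge> 2" and M: "prob_space M" and [measurable]: "X \<in> borel_measurable M"
    and iso: "isotropic M X" and t: "0 \<le> t" "t \<le> 1"
    and le: "\<And>\<theta>. norm \<theta> = 1 \<Longrightarrow> measure M {\<omega> \<in> space M. \<bar>\<theta> \<bullet> X \<omega>\<bar> \<le> t} \<le> c"
  shows "19 / 108 * t \<le> c"
proof -
  interpret prob_space M by fact
  obtain i j :: 'd where ij: "i \<noteq> j"
    using d by (metis card_2_iff' ex_card subset_UNIV)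
  have chart: "prob {\<omega>\<in>space M. \<bar>X \<omega> $ k + s * X \<omega> $ l\<bar> \<le> t} \<le> c" if kl: "k \<noteq> l" for k l :: 'd and s
  proof -
    define v :: "real^'d" where "v = axis k 1 + s *\<^sub>R axis l 1"
    have "1 \<le> norm v"
      using component_le_norm_cart[of v k] kl by (simp add: v_def axis_def)
    then have v: "v \<noteq> 0" "1 \<le> norm v" by auto
    have inner: "v \<bullet> x = x $ k + s * x $ l" for x
      by (simp add: v_def inner_add_left inner_axis')
    have "prob {\<omega>\<in>space M. \<bar>X \<omega> $ k + s * X \<omega> $ l\<bar> \<le> t}
      \<le> prob {\<omega>\<in>space M. \<bar>(v /\<^sub>R norm v) \<bullet> X \<omega>\<bar> \<le> t}"
    proof (rule finite_measure_mono)
      show "{\<omega>\<in>space M. \<bar>X \<omega> $ k + s * X \<omega> $ l\<bar> \<le> t} \<subseteq> {\<omega>\<in>space M. \<bar>(v /\<^sub>R norm v) \<bullet> X \<omega>\<bar> \<le> t}"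
      proof safe
        fix \<omega> assume le: "\<bar>X \<omega> $ k + s * X \<omega> $ l\<bar> \<le> t"
        have "\<bar>(v /\<^sub>R norm v) \<bullet> X \<omega>\<bar> = \<bar>X \<omega> $ k + s * X \<omega> $ l\<bar> / norm v"
          by (simp add: inner abs_mult divide_inverse)
        also have "\<dots> \<le> \<bar>X \<omega> $ k + s * X \<omega> $ l\<bar> / 1"
          using v by (intro divide_left_mono) auto
        finally show "\<bar>(v /\<^sub>R norm v) \<bullet> X \<omega>\<bar> \<le> t" using le by simp
      qed
    qed measurable
    also have "\<dots> \<le> c" using v by (intro le) simp
    finally show ?thesis .
  qed
  have comp[measurable]: "(\<lambda>\<omega>. X \<omega> $ k) \<in> borel_measurable M" for k
    by (rule borel_measurable_continuous_on[of "\<lambda>x. x $ k"]) (auto intro!: continuous_intros)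
  show ?thesis
    using isotropic_second_moment[OF iso] chart ij
    by (intro uniform_slope_bound[of "\<lambda>\<omega>. X \<omega> $ i" "\<lambda>\<omega>. X \<omega> $ j"] t) auto
qed

section \<open>The smallest eigenvalue and the Rayleigh quotient\<close>

lemma symmetric_inner:
  fixes A :: "real ^ 'd ^ 'd"
  assumes "transpose A = A"
  shows "v \<bullet> (A *v w) = (A *v v) \<bullet> w"
  by (metis assms dot_lmul_matrix transpose_matrix_vector)

text \<open>Eigenvectors to different eigenvalues are orthogonal, so there are at most \<open>d\<close> of them. Finiteness
  is what gives \<open>Min\<close> in the definition of \<open>lambda_min\<close> its meaning.\<close>

lemma symmetric_finite_eigenvalues:
  fixes A :: "real ^ 'd ^ 'd"
  assumes sym: "transpose A = A"
  shows "finite {l. eigenvalue A l}"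
proof -
  define E where "E = {l. eigenvalue A l}"
  have "\<forall>l\<in>E. \<exists>v. v \<noteq> 0 \<and> A *v v = l *\<^sub>R v" by (auto simp: E_def eigenvalue_def)
  then obtain f where f: "\<And>l. l \<in> E \<Longrightarrow> f l \<noteq> 0 \<and> A *v f l = l *\<^sub>R f l" by metis
  have orth: "f l \<bullet> f m = 0" if "l \<in> E" "m \<in> E" "l \<noteq> m" for l m
  proof -
    have "m * (f l \<bullet> f m) = l * (f l \<bullet> f m)"
      using symmetric_inner[OF sym, of "f l" "f m"] f[OF that(1)] f[OF that(2)] by simp
    then show ?thesis using that by simp
  qed
  have "inj_on f E" using orth f by (metis inj_onI inner_eq_zero_iff)
  moreover have "independent (f ` E)"
    using orth f by (intro pairwise_orthogonal_independent) (auto simp: pairwise_def orthogonal_def)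
  then have "finite (f ` E)" using independent_bound by blast
  ultimately show ?thesis unfolding E_def[symmetric] by (simp add: finite_image_iff)
qed

text \<open>The minimiser exists by compactness. It is an eigenvector because \<open>Q w = \<langle>w, A w\<rangle> - l \<langle>w, w\<rangle>\<close> is
  nonnegative and vanishes at \<open>v\<close>: a nonzero residual \<open>w = A v - l v\<close> would make \<open>Q\<close> negative at
  \<open>v + e w\<close> for a small negative \<open>e\<close>.\<close>

lemma symmetric_rayleigh_minimizer:
  fixes A :: "real ^ 'd ^ 'd"
  assumes sym: "transpose A = A"
  obtains v where "norm v = 1" "A *v v = (v \<bullet> (A *v v)) *\<^sub>R v"
    "\<And>w. norm w = 1 \<Longrightarrow> v \<bullet> (A *v v) \<le> w \<bullet> (A *v w)"
proof -
  have "continuous_on (sphere 0 1) (\<lambda>v. v \<bullet> (A *v v))"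
    by (intro continuous_intros matrix_vector_mult_linear_continuous_on)
  moreover have "sphere (0 :: real^'d) 1 \<noteq> {}" by simp
  ultimately obtain v where v: "norm v = 1" and min: "\<And>w. norm w = 1 \<Longrightarrow> v \<bullet> (A *v v) \<le> w \<bullet> (A *v w)"
    using continuous_attains_inf[OF compact_sphere, of 0 1 "\<lambda>v. v \<bullet> (A *v v)"] by auto
  define l where "l = v \<bullet> (A *v v)"
  define Q where "Q w = w \<bullet> (A *v w) - l * (w \<bullet> w)" for w
  have Q_nonneg: "0 \<le> Q w" for w
  proof (cases "w = 0")
    case False
    have "l \<le> (w /\<^sub>R norm w) \<bullet> (A *v (w /\<^sub>R norm w))"
      unfolding l_def using False by (intro min) simp
    also have "\<dots> = (w \<bullet> (A *v w)) / (norm w)\<^sup>2"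
      by (simp add: matrix_vector_mult_scaleR divide_inverse power2_eq_square)
    finally show ?thesis
      using False by (simp add: Q_def field_simps power2_norm_eq_inner)
  qed (simp add: Q_def)
  define w where "w = A *v v - l *\<^sub>R v"
  have expand: "Q (v + e *\<^sub>R w) = 2 * e * (w \<bullet> w) + e\<^sup>2 * Q w" for e
  proof -
    have vv: "v \<bullet> v = 1" using v by (simp add: norm_eq_sqrt_inner)
    have Av: "A *v v = w + l *\<^sub>R v" by (simp add: w_def)
    have vAw: "v \<bullet> (A *v w) = (A *v v) \<bullet> w" by (rule symmetric_inner[OF sym])
    have "v \<bullet> w = 0" by (simp add: w_def inner_diff_right vv l_def)
    then show ?thesis
      by (simp add: Q_def matrix_vector_mult_add_rdistrib matrix_vector_mult_scaleR vAw Av vv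
          matrix_vector_right_distrib inner_add_left inner_add_right inner_commute[of w v]
          power2_eq_square algebra_simps)
  qed
  have "w \<bullet> w = 0"
  proof (rule ccontr)
    assume "w \<bullet> w \<noteq> 0"
    then have pos: "0 < w \<bullet> w" by (metis inner_ge_zero order_le_less)
    (* The expansion is minimal at e = - |w|^2 / Q w; adding 1 keeps the denominator positive. *)
    define e where "e = - (w \<bullet> w) / (1 + Q w)"
    have "1 + Q w > 0" using Q_nonneg[of w] by simp
    then have "e < 0" and eQ: "e * (1 + Q w) = - (w \<bullet> w)" using pos by (simp_all add: e_def field_simps)
    have "Q (v + e *\<^sub>R w) = e * (w \<bullet> w + e * (1 + Q w) + (w \<bullet> w - e))"
      by (simp add: expand power2_eq_square algebra_simps)
    also have "\<dots> = e * (w \<bullet> w - e)" by (simp add: eQ)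
    also have "\<dots> < 0"
    proof (rule mult_neg_pos)
      show "0 < w \<bullet> w - e" using \<open>e < 0\<close> pos by linarith
    qed fact
    finally show False using Q_nonneg[of "v + e *\<^sub>R w"] by simp
  qed
  then have "A *v v = l *\<^sub>R v" by (simp add: w_def)
  then show ?thesis using that v min by (simp add: l_def)
qed

lemma lambda_min_le_iff:
  fixes A :: "real ^ 'd ^ 'd"
  assumes sym: "transpose A = A"
  shows "lambda_min A \<le> t \<longleftrightarrow> (\<exists>v\<in>sphere 0 1. v \<bullet> (A *v v) \<le> t)"
proof -
  obtain v where v: "norm v = 1" "A *v v = (v \<bullet> (A *v v)) *\<^sub>R v"
    and min: "\<And>w. norm w = 1 \<Longrightarrow> v \<bullet> (A *v v) \<le> w \<bullet> (A *v w)"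
    using symmetric_rayleigh_minimizer[OF sym] by blast
  have "lambda_min A = v \<bullet> (A *v v)"
    unfolding lambda_min_def
  proof (rule Min_eqI[OF symmetric_finite_eigenvalues[OF sym]])
    fix l assume "l \<in> {l. eigenvalue A l}"
    then obtain u where u: "u \<noteq> 0" "A *v u = l *\<^sub>R u" by (auto simp: eigenvalue_def)
    have "v \<bullet> (A *v v) \<le> (u /\<^sub>R norm u) \<bullet> (A *v (u /\<^sub>R norm u))" using u by (intro min) simp
    also have "\<dots> = l"
      using u by (simp add: matrix_vector_mult_scaleR dot_square_norm power2_eq_square field_simps)
    finally show "v \<bullet> (A *v v) \<le> l" .
  next
    have "v \<noteq> 0" using v(1) by auto
    then show "v \<bullet> (A *v v) \<in> {l. eigenvalue A l}"
      unfolding eigenvalue_def using v(2) by blast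
  qed
  then show ?thesis using v(1) min by (metis mem_sphere_0 order_trans)
qed

section \<open>Sample covariance matrices\<close>

lemma transpose_sample_cov: "transpose (sample_cov n x) = sample_cov n x"
  by (simp add: sample_cov_def outer_self_def transpose_def vec_eq_iff mult.commute)

lemma sample_cov_quadratic_form:
  fixes v :: "real ^ 'd"
  shows "v \<bullet> (sample_cov n x *v v) = (\<Sum>i=1..n. (v \<bullet> x i)\<^sup>2) / real n"
proof -
  have outer: "outer_self y *v v = (v \<bullet> y) *\<^sub>R y" for y
    by (simp add: outer_self_def matrix_vector_mult_def vec_eq_iff inner_vec_def
        sum_distrib_right sum_distrib_left mult_ac)
  have sum: "(\<Sum>i\<in>I. outer_self (x i)) *v v = (\<Sum>i\<in>I. (v \<bullet> x i) *\<^sub>R x i)" for I :: "nat set"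
    by (induction I rule: infinite_finite_induct)
      (simp_all add: matrix_vector_mult_add_rdistrib outer)
  show ?thesis
    by (simp add: sample_cov_def scaleR_matrix_vector_assoc[symmetric] sum inner_sum_right
        power2_eq_square)
qed

text \<open>By the Rayleigh characterisation the event is the preimage of the set of all matrices with
  \<open>\<langle>v, A v\<rangle> \<le> t\<close> for some unit vector \<open>v\<close>, which is closed as the projection of a closed set along the
  compact sphere.\<close>

lemma lambda_min_sample_cov_event:
  fixes Y :: "nat \<Rightarrow> 'b \<Rightarrow> real ^ 'd"
  assumes Y: "\<And>i. i \<in> {1..n} \<Longrightarrow> Y i \<in> borel_measurable N"
  shows "{\<omega> \<in> space N. lambda_min (sample_cov n (\<lambda>i. Y i \<omega>)) \<le> t} \<in> sets N"
proof -
  define C :: "(real^'d^'d) set" where "C = {A. \<exists>v. v \<in> sphere 0 1 \<and> (v, A) \<in> {p. fst p \<bullet> (snd p *v fst p) \<le> t}}"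
  have "closed {p :: (real^'d) \<times> (real^'d^'d). fst p \<bullet> (snd p *v fst p) \<le> t}"
    unfolding matrix_vector_mult_def
    by (intro closed_Collect_le continuous_intros continuous_on_vec_lambda)
  then have C: "C \<in> sets borel"
    unfolding C_def by (intro borel_closed closed_compact_projection compact_sphere)
  have "continuous_on UNIV (outer_self :: real^'d \<Rightarrow> _)"
    unfolding outer_self_def by (intro continuous_on_vec_lambda continuous_intros)
  then have "(\<lambda>\<omega>. outer_self (Y i \<omega>)) \<in> borel_measurable N" if "i \<in> {1..n}" for i
    by (rule borel_measurable_continuous_on) (rule Y[OF that])
  then have [measurable]: "(\<lambda>\<omega>. sample_cov n (\<lambda>i. Y i \<omega>)) \<in> borel_measurable N"
    unfolding sample_cov_def by (intro borel_measurable_scaleR borel_measurable_sum) auto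
  have "{\<omega> \<in> space N. lambda_min (sample_cov n (\<lambda>i. Y i \<omega>)) \<le> t}
      = (\<lambda>\<omega>. sample_cov n (\<lambda>i. Y i \<omega>)) -` C \<inter> space N"
    by (auto simp: C_def lambda_min_le_iff[OF transpose_sample_cov])
  also have "\<dots> \<in> sets N" using C by measurable
  finally show ?thesis .
qed

text \<open>One direction \<open>\<theta>\<close> serves as a test vector for all \<open>n\<close> samples at once, and the \<open>n\<close> events
  \<open>\<bar>\<langle>\<theta>,Y\<^sub>i\<rangle>\<bar> \<le> \<surd>t\<close> are independent.\<close>

lemma lambda_min_sample_cov_prob:
  fixes X :: "'a \<Rightarrow> real ^ 'd"
  assumes iid: "iid_copies M X N n Y" and [measurable]: "X \<in> borel_measurable M"
    and n: "n \<ge> 1" and \<theta>: "norm \<theta> = 1" and t: "0 \<le> t"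
  shows "measure M {\<omega> \<in> space M. \<bar>\<theta> \<bullet> X \<omega>\<bar> \<le> sqrt t} ^ n
    \<le> measure N {\<omega> \<in> space N. lambda_min (sample_cov n (\<lambda>i. Y i \<omega>)) \<le> t}"
proof -
  interpret prob_space N using iid by (simp add: iid_copies_def)
  have indep: "indep_vars (\<lambda>_. borel) Y {1..n}" using iid by (simp add: iid_copies_def)
  have Y: "Y i \<in> borel_measurable N" if "i \<in> {1..n}" for i
    using indep that by (auto simp: indep_vars_def)
  define B where "B = {x. \<bar>\<theta> \<bullet> x\<bar> \<le> sqrt t}"
  have B[measurable]: "B \<in> sets borel"
    unfolding B_def by (intro borel_closed closed_Collect_le continuous_intros)
  have marginal: "prob (Y i -` B \<inter> space N) = measure M {\<omega> \<in> space M. \<bar>\<theta> \<bullet> X \<omega>\<bar> \<le> sqrt t}"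
    if i: "i \<in> {1..n}" for i
  proof -
    have "prob (Y i -` B \<inter> space N) = measure (distr N borel (Y i)) B"
      using Y[OF i] B by (simp add: measure_distr)
    also have "\<dots> = measure (distr M borel X) B" using iid i by (simp add: iid_copies_def)
    also have "\<dots> = measure M (X -` B \<inter> space M)" by (simp add: measure_distr)
    also have "X -` B \<inter> space M = {\<omega> \<in> space M. \<bar>\<theta> \<bullet> X \<omega>\<bar> \<le> sqrt t}" by (auto simp: B_def)
    finally show ?thesis .
  qed
  have "measure M {\<omega> \<in> space M. \<bar>\<theta> \<bullet> X \<omega>\<bar> \<le> sqrt t} ^ n = (\<Prod>i=1..n. prob (Y i -` B \<inter> space N))"
    by (simp add: marginal)
  also have "\<dots> = prob (\<Inter>i\<in>{1..n}. Y i -` B \<inter> space N)"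
    using n B by (intro indep_varsD_finite[OF indep, symmetric]) auto
  also have "\<dots> \<le> prob {\<omega> \<in> space N. lambda_min (sample_cov n (\<lambda>i. Y i \<omega>)) \<le> t}"
  proof (intro finite_measure_mono lambda_min_sample_cov_event Y subsetI)
    fix \<omega> assume \<omega>: "\<omega> \<in> (\<Inter>i\<in>{1..n}. Y i -` B \<inter> space N)"
    have "(\<theta> \<bullet> Y i \<omega>)\<^sup>2 \<le> t" if "i \<in> {1..n}" for i
    proof -
      have "\<bar>\<theta> \<bullet> Y i \<omega>\<bar> \<le> sqrt t" using \<omega> that by (auto simp: B_def)
      from power_mono[OF this, of 2] show ?thesis using t by simp
    qed
    then have "(\<Sum>i=1..n. (\<theta> \<bullet> Y i \<omega>)\<^sup>2) \<le> (\<Sum>i=1..n. t)" by (intro sum_mono)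
    then have "\<theta> \<bullet> (sample_cov n (\<lambda>i. Y i \<omega>) *v \<theta>) \<le> t"
      using n by (simp add: sample_cov_quadratic_form field_simps)
    then show "\<omega> \<in> {\<omega> \<in> space N. lambda_min (sample_cov n (\<lambda>i. Y i \<omega>)) \<le> t}"
      using \<omega> n \<theta> by (auto simp: lambda_min_le_iff[OF transpose_sample_cov])
  qed auto
  finally show ?thesis .
qed

theorem proposition4:
  fixes M :: "'a measure" and X :: "'a \<Rightarrow> real ^ 'd" and t :: real
  assumes "CARD('d) \<ge> 2"
    and "prob_space M"
    and "X \<in> borel_measurable M"
    and "isotropic M X"
    and "0 \<le> t" and "t \<le> 1"
  shows "(SUP \<theta>\<in>sphere 0 1. measure M {\<omega> \<in> space M. \<bar>\<theta> \<bullet> X \<omega>\<bar> \<le> t}) \<ge> 0.16 * t \<and>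
    (\<forall>(N :: 'b measure) (n :: nat) (Y :: nat \<Rightarrow> 'b \<Rightarrow> real ^ 'd).
       n \<ge> 1 \<longrightarrow> iid_copies M X N n Y \<longrightarrow>
       measure N {\<omega> \<in> space N. lambda_min (sample_cov n (\<lambda>i. Y i \<omega>)) \<le> t}
         \<ge> (0.025 * t) powr (real n / 2))"
proof (intro conjI allI impI)
  interpret prob_space M by fact
  note bound = small_ball_sup_bound[OF assms(1-4)]
  have bdd: "bdd_above ((\<lambda>\<theta>. prob {\<omega> \<in> space M. \<bar>\<theta> \<bullet> X \<omega>\<bar> \<le> t}) ` sphere 0 1)"
    by (rule bdd_aboveI2[of _ _ 1]) simp
  have "19 / 108 * t \<le> (SUP \<theta>\<in>sphere 0 1. prob {\<omega> \<in> space M. \<bar>\<theta> \<bullet> X \<omega>\<bar> \<le> t})"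
    using assms(5,6) by (intro bound cSUP_upper bdd) auto
  then show "0.16 * t \<le> (SUP \<theta>\<in>sphere 0 1. prob {\<omega> \<in> space M. \<bar>\<theta> \<bullet> X \<omega>\<bar> \<le> t})"
    using assms(5) by simp
  fix N :: "'b measure" and n :: nat and Y :: "nat \<Rightarrow> 'b \<Rightarrow> real ^ 'd"
  assume n: "n \<ge> 1" and iid: "iid_copies M X N n Y"
  show "(0.025 * t) powr (real n / 2)
    \<le> measure N {\<omega> \<in> space N. lambda_min (sample_cov n (\<lambda>i. Y i \<omega>)) \<le> t}"
  proof (cases "t = 0")
    case True
    then show ?thesis by simp
  next
    case False
    then have t: "0 < t" "t \<le> 1" using assms by auto
    (* The supremum need not be attained; the slack 0.16 < 19/108 yields an actual direction. *)
    have "\<exists>\<theta> :: real^'d. norm \<theta> = 1 \<and> 0.16 * sqrt t \<le> prob {\<omega> \<in> space M. \<bar>\<theta> \<bullet> X \<omega>\<bar> \<le> sqrt t}"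
    proof (rule ccontr)
      assume "\<not> ?thesis"
      then have "prob {\<omega> \<in> space M. \<bar>\<theta> \<bullet> X \<omega>\<bar> \<le> sqrt t} \<le> 0.16 * sqrt t" if "norm \<theta> = 1" for \<theta>
        using that by (metis linear)
      then have "19 / 108 * sqrt t \<le> 0.16 * sqrt t" using t by (intro bound) auto
      then show False using t by simp
    qed
    then obtain \<theta> :: "real^'d" where \<theta>: "norm \<theta> = 1"
      and large: "0.16 * sqrt t \<le> prob {\<omega> \<in> space M. \<bar>\<theta> \<bullet> X \<omega>\<bar> \<le> sqrt t}" by blast
    have "(0.025 * t) powr (real n / 2) = (sqrt (0.025 * t)) powr real n"
      using t by (simp add: powr_half_sqrt[symmetric] powr_powr)
    also have "\<dots> = sqrt (0.025 * t) ^ n" using t by (intro powr_realpow) simp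
    also have "\<dots> \<le> (0.16 * sqrt t) ^ n"
    proof (intro power_mono real_le_lsqrt)
      show "0.025 * t \<le> (0.16 * sqrt t)\<^sup>2" using t by (simp add: power_mult_distrib power2_eq_square)
    qed (use t in auto)
    also have "\<dots> \<le> prob {\<omega> \<in> space M. \<bar>\<theta> \<bullet> X \<omega>\<bar> \<le> sqrt t} ^ n"
      using large t by (intro power_mono) auto
    also have "\<dots> \<le> measure N {\<omega> \<in> space N. lambda_min (sample_cov n (\<lambda>i. Y i \<omega>)) \<le> t}"
      using t by (intro lambda_min_sample_cov_prob[OF iid assms(3) n \<theta>]) simp
    finally show ?thesis .
  qed
qed

end
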